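(* Let $(X,r)$ be an involutive non-degenerate set-theoretic solution to the Yang--Baxter equation and let $k\colon X\to X$ be an involutive reflection of $(X,r)$. Let $V=\mathbb{C}X$, and for $u\in\mathbb{C}$ let $R(u)=\mathrm{id}+ur\colon V\otimes V\to V\otimes V$, let $K(u)\colon V\to V$ be the linear map with $K(u)(x)=uk(x)$ for $x\in X$, and let $K_2(u)=\mathrm{id}\otimes K(u)$. Then $$K_{2}(v)R(u+v)K_{2}(u)R(u-v)=R(u-v)K_{2}(u)R(u+v)K_{2}(v)$$ for all $u,v\in\mathbb{C}$.
   Context: A set-theoretic solution to the Yang--Baxter equation is a pair $(X,r)$, where $X$ is a set and $r\colon X\times X\to X\times X$ is bijective with $(r\times\mathrm{id})(\mathrm{id}\times r)(r\times\mathrm{id})=(\mathrm{id}\times r)(r\times\mathrm{id})(\mathrm{id}\times r)$. Write $r(x,y)=(\sigma_x(y),\tau_y(x))$; the solution is non-degenerate if all $\sigma_x,\tau_x\colon X\to X$ are bijective, and involutive if $r^2=\mathrm{id}$. A map $k\colon X\to X$ is a reflection of a non-degenerate solution $(X,r)$ if $r(\mathrm{id}\times k)r(\mathrm{id}\times k)=(\mathrm{id}\times k)r(\mathrm{id}\times k)r$; it is an involutive reflection if moreover $k^2=\mathrm{id}$. $V=\mathbb{C}X$ is the complex vector space with basis $X$. The same letter $r$ denotes the linear map $V\otimes V\to V\otimes V$ with $r(x\otimes y)=\sigma_x(y)\otimes\tau_y(x)$ for $x,y\in X$. *)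

theory Defs
  imports Complex_Main "HOL-Library.Poly_Mapping" "HOL-Library.FuncSet"
begin

text \<open>The set X is an arbitrary carrier (possibly empty or infinite) in a type. The maps are total
  HOL functions, and only their values on the carrier are constrained. Write
  r (x, y) = (sig r x y, tau r y x).\<close>

definition sig :: "('a \<times> 'a \<Rightarrow> 'a \<times> 'a) \<Rightarrow> 'a \<Rightarrow> 'a \<Rightarrow> 'a"
  where "sig r x y = fst (r (x, y))"

definition tau :: "('a \<times> 'a \<Rightarrow> 'a \<times> 'a) \<Rightarrow> 'a \<Rightarrow> 'a \<Rightarrow> 'a"
  where "tau r y x = snd (r (x, y))"

text \<open>The maps \<open>r \<times> id\<close> and \<open>id \<times> r\<close> on triples, where \<open>(x, y, z)\<close> is \<open>(x, (y, z))\<close> in HOL.\<close>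

definition r12 :: "('a \<times> 'a \<Rightarrow> 'a \<times> 'a) \<Rightarrow> 'a \<times> 'a \<times> 'a \<Rightarrow> 'a \<times> 'a \<times> 'a"
  where "r12 r = (\<lambda>(x, y, z). let (a, b) = r (x, y) in (a, b, z))"

definition r23 :: "('a \<times> 'a \<Rightarrow> 'a \<times> 'a) \<Rightarrow> 'a \<times> 'a \<times> 'a \<Rightarrow> 'a \<times> 'a \<times> 'a"
  where "r23 r = map_prod id r"

definition yb_solution :: "'a set \<Rightarrow> ('a \<times> 'a \<Rightarrow> 'a \<times> 'a) \<Rightarrow> bool"
  where "yb_solution X r \<longleftrightarrow>
    bij_betw r (X \<times> X) (X \<times> X) \<and>
    (\<forall>t \<in> X \<times> X \<times> X. (r12 r \<circ> r23 r \<circ> r12 r) t = (r23 r \<circ> r12 r \<circ> r23 r) t)"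

definition non_degenerate :: "'a set \<Rightarrow> ('a \<times> 'a \<Rightarrow> 'a \<times> 'a) \<Rightarrow> bool"
  where "non_degenerate X r \<longleftrightarrow>
    (\<forall>x \<in> X. bij_betw (sig r x) X X \<and> bij_betw (tau r x) X X)"

definition involutive_on :: "'b set \<Rightarrow> ('b \<Rightarrow> 'b) \<Rightarrow> bool"
  where "involutive_on A f \<longleftrightarrow> (\<forall>p \<in> A. (f \<circ> f) p = p)"

definition reflection :: "'a set \<Rightarrow> ('a \<times> 'a \<Rightarrow> 'a \<times> 'a) \<Rightarrow> ('a \<Rightarrow> 'a) \<Rightarrow> bool"
  where "reflection X r k \<longleftrightarrow>
    k \<in> X \<rightarrow> X \<and>
    (\<forall>p \<in> X \<times> X. (r \<circ> map_prod id k \<circ> r \<circ> map_prod id k) p =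
                  (map_prod id k \<circ> r \<circ> map_prod id k \<circ> r) p)"

text \<open>The space \<open>\<complex>X\<close> consists of the finitely supported functions with support in X; the
  basis vector of \<open>x \<in> X\<close> is \<open>bvec x\<close>.\<close>

definition free_space :: "'b set \<Rightarrow> ('b \<Rightarrow>\<^sub>0 complex) set"
  where "free_space B = {p. Poly_Mapping.keys p \<subseteq> B}"

definition bvec :: "'b \<Rightarrow> ('b \<Rightarrow>\<^sub>0 complex)"
  where "bvec b = Poly_Mapping.single b 1"

definition scl :: "complex \<Rightarrow> ('b \<Rightarrow>\<^sub>0 complex) \<Rightarrow> ('b \<Rightarrow>\<^sub>0 complex)"
  where "scl c = Poly_Mapping.map ((*) c)"

text \<open>\<open>lin_ext f\<close> is the linear map sending each basis vector \<open>bvec b\<close> to \<open>f b\<close>.\<close>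

definition lin_ext :: "('b \<Rightarrow> ('c \<Rightarrow>\<^sub>0 complex)) \<Rightarrow> ('b \<Rightarrow>\<^sub>0 complex) \<Rightarrow> ('c \<Rightarrow>\<^sub>0 complex)"
  where "lin_ext f p = (\<Sum>b \<in> Poly_Mapping.keys p. scl (Poly_Mapping.lookup p b) (f b))"

text \<open>The tensor product of \<open>\<complex>X\<close> and \<open>\<complex>Y\<close> is realised as \<open>\<complex>(X \<times> Y)\<close>, with
  \<open>x \<otimes> y\<close> being the basis vector of \<open>(x, y)\<close>. The tensor product of vectors is extended
  bilinearly, and that of linear maps is determined by
  \<open>(f \<otimes> g)(x \<otimes> y) = f x \<otimes> g y\<close> on basis vectors.\<close>

definition tensor :: "('b \<Rightarrow>\<^sub>0 complex) \<Rightarrow> ('c \<Rightarrow>\<^sub>0 complex) \<Rightarrow> ('b \<times> 'c \<Rightarrow>\<^sub>0 complex)"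
  where "tensor p q = lin_ext (\<lambda>x. lin_ext (\<lambda>y. bvec (x, y)) q) p"

definition tensor_map ::
    "(('b \<Rightarrow>\<^sub>0 complex) \<Rightarrow> ('d \<Rightarrow>\<^sub>0 complex)) \<Rightarrow> (('c \<Rightarrow>\<^sub>0 complex) \<Rightarrow> ('e \<Rightarrow>\<^sub>0 complex))
      \<Rightarrow> ('b \<times> 'c \<Rightarrow>\<^sub>0 complex) \<Rightarrow> ('d \<times> 'e \<Rightarrow>\<^sub>0 complex)"
  where "tensor_map f g = lin_ext (\<lambda>(x, y). tensor (f (bvec x)) (g (bvec y)))"

definition lin_r :: "('a \<times> 'a \<Rightarrow> 'a \<times> 'a) \<Rightarrow> ('a \<times> 'a \<Rightarrow>\<^sub>0 complex) \<Rightarrow> ('a \<times> 'a \<Rightarrow>\<^sub>0 complex)"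
  where "lin_r r = lin_ext (\<lambda>(x, y). tensor (bvec (sig r x y)) (bvec (tau r y x)))"

definition R_op :: "('a \<times> 'a \<Rightarrow> 'a \<times> 'a) \<Rightarrow> complex
    \<Rightarrow> ('a \<times> 'a \<Rightarrow>\<^sub>0 complex) \<Rightarrow> ('a \<times> 'a \<Rightarrow>\<^sub>0 complex)"
  where "R_op r u w = w + scl u (lin_r r w)"

definition K_op :: "('a \<Rightarrow> 'a) \<Rightarrow> complex \<Rightarrow> ('a \<Rightarrow>\<^sub>0 complex) \<Rightarrow> ('a \<Rightarrow>\<^sub>0 complex)"
  where "K_op k u = lin_ext (\<lambda>x. scl u (bvec (k x)))"

definition K2_op :: "('a \<Rightarrow> 'a) \<Rightarrow> complex
    \<Rightarrow> ('a \<times> 'a \<Rightarrow>\<^sub>0 complex) \<Rightarrow> ('a \<times> 'a \<Rightarrow>\<^sub>0 complex)"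
  where "K2_op k u = tensor_map id (K_op k u)"

lemma lookup_scl [simp]: "Poly_Mapping.lookup (scl c p) b = c * Poly_Mapping.lookup p b"
  by (simp add: scl_def Poly_Mapping.map.rep_eq when_def)

lemma vector_space_scl: "vector_space (scl :: complex \<Rightarrow> ('b \<Rightarrow>\<^sub>0 complex) \<Rightarrow> _)"
  by unfold_locales (auto intro!: poly_mapping_eqI simp: lookup_add algebra_simps)

interpretation scl: vector_space "scl :: complex \<Rightarrow> ('b \<Rightarrow>\<^sub>0 complex) \<Rightarrow> _"
  by (rule vector_space_scl)

lemma lin_ext_superset:
  assumes "finite A" "Poly_Mapping.keys p \<subseteq> A"
  shows "lin_ext f p = (\<Sum>b \<in> A. scl (Poly_Mapping.lookup p b) (f b))"
  unfolding lin_ext_def using assms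
  by (intro sum.mono_neutral_left) (auto simp: in_keys_iff)

lemma lin_ext_bvec [simp]: "lin_ext f (bvec b) = f b"
  by (simp add: lin_ext_def bvec_def)

lemma lin_ext_add: "lin_ext f (p + q) = lin_ext f p + lin_ext f q"
proof -
  let ?A = "Poly_Mapping.keys p \<union> Poly_Mapping.keys q"
  have "Poly_Mapping.keys (p + q) \<subseteq> ?A" by (rule Poly_Mapping.keys_add)
  then show ?thesis
    by (simp add: lin_ext_superset[of ?A] lookup_add scl.scale_left_distrib sum.distrib)
qed

lemma lin_ext_scl: "lin_ext f (scl c p) = scl c (lin_ext f p)"
proof -
  have "Poly_Mapping.keys (scl c p) \<subseteq> Poly_Mapping.keys p"
    by (auto simp: in_keys_iff)
  then show ?thesis
    by (simp add: lin_ext_superset[of "Poly_Mapping.keys p"] scl.scale_sum_right)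
qed

lemma linear_lin_ext: "Vector_Spaces.linear scl scl (lin_ext f)"
  by (intro Vector_Spaces.linear.intro module_hom.intro vector_space_scl module_hom_axioms.intro
        lin_ext_add lin_ext_scl scl.module_axioms)

lemma bvec_expansion: "lin_ext bvec p = p"
proof (rule poly_mapping_eqI)
  fix b
  show "Poly_Mapping.lookup (lin_ext bvec p) b = Poly_Mapping.lookup p b"
    by (auto simp: lin_ext_def lookup_sum bvec_def lookup_single when_def if_distrib
        in_keys_iff cong: if_cong)
qed

lemma linear_eq_lin_ext:
  assumes "Vector_Spaces.linear scl scl f"
  shows "f = lin_ext (\<lambda>b. f (bvec b))"
proof
  fix p
  interpret f: Vector_Spaces.linear scl scl f by (rule assms)
  have "f p = f (lin_ext bvec p)" by (simp add: bvec_expansion)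
  also have "\<dots> = lin_ext (\<lambda>b. f (bvec b)) p"
    by (simp add: lin_ext_def f.sum f.scale)
  finally show "f p = lin_ext (\<lambda>b. f (bvec b)) p" .
qed

lemma free_space_eq_span: "free_space B = scl.span (bvec ` B)"
proof
  show "free_space B \<subseteq> scl.span (bvec ` B)"
  proof
    fix p :: "'a \<Rightarrow>\<^sub>0 complex" assume "p \<in> free_space B"
    then have "lin_ext bvec p \<in> scl.span (bvec ` B)"
      unfolding lin_ext_def free_space_def
      by (intro scl.span_sum scl.span_scale scl.span_base) auto
    then show "p \<in> scl.span (bvec ` B)" by (simp add: bvec_expansion)
  qed
  have "scl.subspace (free_space B)"
    by (auto simp: scl.subspace_def free_space_def in_keys_iff lookup_add subset_iff)
       (metis add.right_neutral)
  moreover have "bvec ` B \<subseteq> free_space B"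
    by (auto simp: free_space_def bvec_def)
  ultimately show "scl.span (bvec ` B) \<subseteq> free_space B"
    by (rule scl.span_minimal[rotated])
qed

lemma bvec_notin_span: "b \<notin> B \<Longrightarrow> bvec b \<notin> scl.span (bvec ` B)"
  unfolding free_space_eq_span[symmetric] by (simp add: free_space_def bvec_def)

lemma independent_bvec: "\<not> scl.dependent (bvec ` B)"
proof
  assume "scl.dependent (bvec ` B)"
  then obtain b where b: "b \<in> B" "bvec b \<in> scl.span (bvec ` B - {bvec b})"
    unfolding scl.dependent_def by auto
  have "bvec ` B - {bvec b} \<subseteq> bvec ` (B - {b})" by auto
  then have "bvec b \<in> scl.span (bvec ` (B - {b}))"
    using b(2) scl.span_mono by blast
  then show False using bvec_notin_span[of b "B - {b}"] by simp
qed

lemma tensor_bvec [simp]: "tensor (bvec x) (bvec y) = bvec (x, y)"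
  by (simp add: tensor_def)

lemma lin_ext_sum: "lin_ext f (\<Sum>i\<in>A. g i) = (\<Sum>i\<in>A. lin_ext f (g i))"
  using module_hom.sum[OF linear_lin_ext[unfolded Vector_Spaces.linear_def, THEN conjunct2, THEN conjunct2]]
  by blast

lemma lookup_tensor:
  "Poly_Mapping.lookup (tensor p q) (x, y) = Poly_Mapping.lookup p x * Poly_Mapping.lookup q y"
proof -
  have "Poly_Mapping.lookup (tensor p q) (x, y) =
    (\<Sum>a\<in>Poly_Mapping.keys p. \<Sum>b\<in>Poly_Mapping.keys q.
       if a = x \<and> b = y then Poly_Mapping.lookup p a * Poly_Mapping.lookup q b else 0)"
    unfolding tensor_def lin_ext_def lookup_sum lookup_scl sum_distrib_left
    by (intro sum.cong refl) (auto simp: bvec_def lookup_single when_def)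
  also have "\<dots> = (\<Sum>a\<in>Poly_Mapping.keys p. if a = x then \<Sum>b\<in>Poly_Mapping.keys q.
       if b = y then Poly_Mapping.lookup p a * Poly_Mapping.lookup q b else 0 else 0)"
    by (intro sum.cong refl) auto
  also have "\<dots> = Poly_Mapping.lookup p x * Poly_Mapping.lookup q y"
    by (auto simp: in_keys_iff)
  finally show ?thesis .
qed

lemma tensor_add_left: "tensor (p + p') q = tensor p q + tensor p' q"
  and tensor_add_right: "tensor p (q + q') = tensor p q + tensor p q'"
  and tensor_scl_left: "tensor (scl c p) q = scl c (tensor p q)"
  and tensor_scl_right: "tensor p (scl c q) = scl c (tensor p q)"
  by (auto intro!: poly_mapping_eqI simp: lookup_tensor lookup_add algebra_simps)

lemma tensor_map_tensor:
  assumes f: "Vector_Spaces.linear scl scl f" and g: "Vector_Spaces.linear scl scl g"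
  shows "tensor_map f g (tensor p q) = tensor (f p) (g q)"
proof -
  interpret f: Vector_Spaces.linear scl scl f by (rule f)
  interpret g: Vector_Spaces.linear scl scl g by (rule g)
  have s1: "tensor (\<Sum>i\<in>A. h i) w = (\<Sum>i\<in>A. tensor (h i) w)" for A and w :: "'e \<Rightarrow>\<^sub>0 complex"
    and h :: "'x \<Rightarrow> ('y \<Rightarrow>\<^sub>0 complex)"
    by (auto intro!: poly_mapping_eqI simp: lookup_tensor lookup_sum sum_distrib_right)
  have s2: "tensor w (\<Sum>i\<in>A. h i) = (\<Sum>i\<in>A. tensor w (h i))" for A and w :: "'y \<Rightarrow>\<^sub>0 complex"
    and h :: "'x \<Rightarrow> ('z \<Rightarrow>\<^sub>0 complex)"
    by (auto intro!: poly_mapping_eqI simp: lookup_tensor lookup_sum sum_distrib_left)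
  have "tensor_map f g (tensor p q) =
      (\<Sum>x\<in>Poly_Mapping.keys p. \<Sum>y\<in>Poly_Mapping.keys q.
        scl (Poly_Mapping.lookup p x) (scl (Poly_Mapping.lookup q y) (tensor (f (bvec x)) (g (bvec y)))))"
    unfolding tensor_map_def tensor_def[of p q]
    by (simp add: lin_ext_def[of _ p] lin_ext_def[of _ q] lin_ext_sum lin_ext_scl scl.scale_sum_right del: scl.scale_scale)
  also have "\<dots> = tensor (lin_ext (\<lambda>x. f (bvec x)) p) (lin_ext (\<lambda>y. g (bvec y)) q)"
    by (simp add: lin_ext_def s1 s2 tensor_scl_left tensor_scl_right scl.scale_sum_right)
       (subst sum.swap, simp add: mult.commute)
  finally show ?thesis
    by (simp flip: linear_eq_lin_ext[OF f] linear_eq_lin_ext[OF g])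
qed

lemma lin_r_bvec: "lin_r r (bvec (x, y)) = bvec (r (x, y))"
  by (simp add: lin_r_def sig_def tau_def)

lemma K2_op_bvec: "K2_op k u (bvec (x, y)) = tensor (bvec x) (scl u (bvec (k y)))"
  by (simp add: K2_op_def tensor_map_def K_op_def)

end

theory Submission
  imports Defs
begin

text \<open>Write \<open>T = id \<otimes> k\<close>, so that \<open>K\<^sub>2(u) = u T\<close> with \<open>T\<^sup>2 = id\<close>. Both sides expand to
  \<open>u v (id + (u - v) r + (u + v) T r T + (u\<^sup>2 - v\<^sup>2) Q)\<close>, where \<open>Q = T r T r\<close> on the left and
  \<open>Q = r T r T\<close> on the right; these agree by the reflection equation.\<close>

lemma R_op_bvec: "R_op r u (bvec p) = bvec p + scl u (bvec (r p))"
  by (cases p) (simp add: R_op_def lin_r_bvec)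

text \<open>The scalar leaves the second tensor factor, so operator products on basis vectors reduce
  to composing maps of pairs.\<close>

lemma K2_op_bvec_map_prod: "K2_op k u (bvec p) = scl u (bvec (map_prod id k p))"
  by (cases p) (simp add: K2_op_bvec tensor_scl_right)

lemma linear_R_op: "Vector_Spaces.linear scl scl (R_op r u)"
  by (intro Vector_Spaces.linear.intro module_hom.intro vector_space_scl module_hom_axioms.intro
        scl.module_axioms)
     (simp_all add: R_op_def lin_r_def lin_ext_add lin_ext_scl scl.scale_right_distrib mult.commute)

lemma linear_K2_op: "Vector_Spaces.linear scl scl (K2_op k u)"
  by (simp add: K2_op_def tensor_map_def linear_lin_ext)

text \<open>Only basis vectors indexed by \<open>B\<close> occur in \<open>w\<close>. This
  restriction matters because the hypotheses on \<open>r\<close> and \<open>k\<close> say nothing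
  off the carrier.\<close>

lemma linear_eq_on_free_space:
  assumes "Vector_Spaces.linear scl scl f" "Vector_Spaces.linear scl scl g"
    and "\<And>b. b \<in> B \<Longrightarrow> f (bvec b) = g (bvec b)" and "w \<in> free_space B"
  shows "f w = g w"
proof -
  have "lin_ext (\<lambda>b. f (bvec b)) w = lin_ext (\<lambda>b. g (bvec b)) w"
    unfolding lin_ext_def using assms(3,4) by (intro sum.cong) (auto simp: free_space_def)
  then show ?thesis
    by (simp flip: linear_eq_lin_ext[OF assms(1)] linear_eq_lin_ext[OF assms(2)])
qed

theorem theorem5p1:
  fixes X :: "'a set"
    and r :: "'a \<times> 'a \<Rightarrow> 'a \<times> 'a"
    and k :: "'a \<Rightarrow> 'a"
  assumes "yb_solution X r"
    and "non_degenerate X r"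
    and "involutive_on (X \<times> X) r"
    and "reflection X r k"
    and "involutive_on X k"
  shows "\<forall>u v :: complex. \<forall>w \<in> free_space (X \<times> X).
    (K2_op k v \<circ> R_op r (u + v) \<circ> K2_op k u \<circ> R_op r (u - v)) w =
    (R_op r (u - v) \<circ> K2_op k u \<circ> R_op r (u + v) \<circ> K2_op k v) w"
proof (intro allI ballI)
  fix u v :: complex and w :: "'a \<times> 'a \<Rightarrow>\<^sub>0 complex"
  assume w: "w \<in> free_space (X \<times> X)"
  define T :: "'a \<times> 'a \<Rightarrow> 'a \<times> 'a" where "T = map_prod id k"
  \<comment> \<open>The left side contains \<open>T (T (r p))\<close>, which \<open>T_T\<close> can
    cancel only when \<open>r p\<close> lies in the carrier.\<close>
  have r_closed: "r p \<in> X \<times> X" if "p \<in> X \<times> X" for p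
    using assms(1) that unfolding yb_solution_def by (blast dest: bij_betwE)
  have T_T: "T (T p) = p" if "p \<in> X \<times> X" for p
    using assms(5) that by (auto simp: T_def involutive_on_def)
  have refl: "r (T (r (T p))) = T (r (T (r p)))" if "p \<in> X \<times> X" for p
    using assms(4) that unfolding reflection_def T_def comp_def by blast
  have K2: "K2_op k a (bvec p) = scl a (bvec (T p))" for a p
    by (simp add: K2_op_bvec_map_prod T_def)
  interpret K2: Vector_Spaces.linear scl scl "K2_op k a" for a by (rule linear_K2_op)
  interpret R: Vector_Spaces.linear scl scl "R_op r a" for a by (rule linear_R_op)
  show "(K2_op k v \<circ> R_op r (u + v) \<circ> K2_op k u \<circ> R_op r (u - v)) w =
    (R_op r (u - v) \<circ> K2_op k u \<circ> R_op r (u + v) \<circ> K2_op k v) w"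
  proof (rule linear_eq_on_free_space[OF _ _ _ w])
    fix p assume p: "p \<in> X \<times> X"
    show "(K2_op k v \<circ> R_op r (u + v) \<circ> K2_op k u \<circ> R_op r (u - v)) (bvec p) =
      (R_op r (u - v) \<circ> K2_op k u \<circ> R_op r (u + v) \<circ> K2_op k v) (bvec p)"
      \<comment> \<open>\<open>T_T\<close> serves at \<open>p\<close> on the right and at
        \<open>r p\<close> on the left, and \<open>refl\<close> matches the terms with two factors
        \<open>r\<close>. What remains is an identity of complex coefficients, checked at each basis
        element.\<close>
      using p r_closed[OF p]
      by (simp add: K2 R_op_bvec K2.add K2.scale R.add R.scale T_T refl del: scl.scale_scale)
         (rule poly_mapping_eqI, simp add: lookup_add algebra_simps)
  \<comment> \<open>Both sides are linear as composites of four linear operators.\<close>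
  qed (rule linear_K2_op linear_R_op Vector_Spaces.linear_compose)+
qed

end
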